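(* There is an absolute constant $K>0$ such that the following holds. Let $d\ge1$, $N\ge2$, let $\alpha_1,\dots,\alpha_d$ be real numbers, and let $w_n=(\alpha_1 n,\dots,\alpha_d n)\in(\mathbb{R}/\mathbb{Z})^d$. For each $i\in\{1,\dots,N\}$ choose $j=j(i)\in\{1,\dots,N\}$ with $j\ne i$ such that $\|w_i-w_j\|$ is minimal. Then the set $D=\{\pm(w_i-w_{j(i)}): i=1,\dots,N\}$ has at most $K(4/3)^d$ distinct elements.
   Context: For $t=(t_1,\dots,t_d)\in(\mathbb{R}/\mathbb{Z})^d$, $\|t\|=\min_{n\in\mathbb{Z}^d}|t-n|=\left(\sum_{i=1}^d\min_{n_i\in\mathbb{Z}}|t_i-n_i|^2\right)^{1/2}$, and the distance between $x,y$ is $\|x-y\|$. *)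

theory Defs
  imports Complex_Main
begin

definition dist_Z :: "real \<Rightarrow> real" where
  "dist_Z x = (INF n::int. \<bar>x - of_int n\<bar>)"

definition torus_norm :: "nat \<Rightarrow> (nat \<Rightarrow> real) \<Rightarrow> real" where
  "torus_norm d t = sqrt (\<Sum>k<d. (dist_Z (t k))\<^sup>2)"

text \<open>Canonical representative of the class of t in (R/Z)^d: coordinates in [0,1),
  zero outside 0..d-1. Two representatives define the same torus point iff
  their canonical representatives are equal.\<close>
definition torus_class :: "nat \<Rightarrow> (nat \<Rightarrow> real) \<Rightarrow> (nat \<Rightarrow> real)" where
  "torus_class d t = (\<lambda>k. if k < d then frac (t k) else 0)"

definition wpt :: "(nat \<Rightarrow> real) \<Rightarrow> nat \<Rightarrow> (nat \<Rightarrow> real)" where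
  "wpt \<alpha> n = (\<lambda>k. \<alpha> k * real n)"

end

theory Submission
  imports Defs "HOL-Computational_Algebra.Polynomial"
begin

text \<open>
  Let \<open>h = (N - 1) div 2\<close>. For every \<open>l \<le> h\<close> each index has a neighbour at index distance \<open>l\<close>, so
  the index distance \<open>m\<close> to a nearest point satisfies \<open>\<parallel>m\<alpha>\<parallel> \<le> \<parallel>l\<alpha>\<parallel>\<close>. Hence among the
  distances up to \<open>h\<close>, and likewise among those above \<open>h\<close>, the difference of two of them has norm at
  least that of either, so that their shortest representatives in Euclidean space pairwise enclose
  angles of at least 60 degrees. It remains to bound such spherical codes by \<open>O((4/3)^d)\<close>, which is
  the linear programming bound of Kabatiansky and Levenshtein.

  Let \<open>q\<^sub>k\<close> be the monic Gegenbauer polynomials of the sphere, with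
  \<open>t q\<^sub>k = q\<^sub>k\<^sub>+\<^sub>1 + \<beta>\<^sub>k q\<^sub>k\<^sub>-\<^sub>1\<close>. The test polynomial is \<open>(t - s) g\<^sup>2\<close>, where \<open>g\<close> combines
  \<open>L\<close> consecutive \<open>q\<^sub>k\<close> with weights that form an approximate eigenvector of the truncated
  recurrence for an eigenvalue above \<open>s\<close>, so that \<open>(t - s) g\<close> again has nonnegative coefficients. For
  \<open>s = 1/2\<close> and \<open>k\<close> about \<open>2d/25\<close> this works because \<open>2 \<surd>\<beta>\<^sub>k > 1/2\<close>. The resulting bound is a
  constant times the dimension of the space of spherical harmonics of degree \<open>2d/25\<close>, which is
  \<open>O((4/3)^d)\<close>.
\<close>

section \<open>Positive definite zonal kernels\<close>

type_synonym vec = "nat \<Rightarrow> real"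
type_synonym kernel = "vec \<Rightarrow> vec \<Rightarrow> real"

definition dot :: "nat \<Rightarrow> vec \<Rightarrow> vec \<Rightarrow> real" where
  "dot n x y = (\<Sum>i<n. x i * y i)"

definition unit_vec :: "nat \<Rightarrow> vec \<Rightarrow> bool" where
  "unit_vec n x \<longleftrightarrow> dot n x x = 1"

lemma dot_commute: "dot n x y = dot n y x"
  by (simp add: dot_def mult.commute)

lemma dot_divide_left: "dot n (\<lambda>i. x i / c) y = dot n x y / c"
  by (simp add: dot_def sum_divide_distrib)

lemma dot_divide_right: "dot n x (\<lambda>i. y i / c) = dot n x y / c"
  by (simp add: dot_def sum_divide_distrib)

lemma dot_self_nonneg: "dot n x x \<ge> 0"
  by (simp add: dot_def sum_nonneg)

lemma dot_upd_add:
  assumes "m < n"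
  shows "dot n (x(m := x m + h)) y = dot n x y + h * y m"
proof -
  have "(x(m := x m + h)) i * y i = x i * y i + (if i = m then h * y i else 0)" for i
    by (simp add: distrib_right)
  then show ?thesis
    using assms by (simp add: dot_def sum.distrib del: fun_upd_apply)
qed

lemma abs_coord_le_1:
  assumes "unit_vec n x" "m < n"
  shows "\<bar>x m\<bar> \<le> 1"
proof -
  have "(x m)\<^sup>2 \<le> (\<Sum>i<n. (x i)\<^sup>2)"
    using assms(2) by (intro member_le_sum) auto
  also have "\<dots> = 1"
    using assms(1) by (simp add: unit_vec_def dot_def power2_eq_square)
  finally show ?thesis
    by (simp add: abs_square_le_1)
qed

text \<open>The radicand is \<open>|x + h e\<^sub>m|\<^sup>2\<close> for a unit vector \<open>x\<close>, so that the curve stays on the sphere.\<close>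

definition tangent_curve :: "nat \<Rightarrow> vec \<Rightarrow> real \<Rightarrow> vec" where
  "tangent_curve m x h = (\<lambda>i. (x(m := x m + h)) i / sqrt (1 + 2 * h * x m + h\<^sup>2))"

lemma tangent_curve_0 [simp]: "tangent_curve m x 0 = x"
  by (simp add: tangent_curve_def)

lemma unit_vec_tangent_curve:
  assumes "unit_vec n x" "m < n" "\<bar>h\<bar> < 1"
  shows "unit_vec n (tangent_curve m x h)"
proof -
  let ?y = "x(m := x m + h)" and ?r = "1 + 2 * h * x m + h\<^sup>2"
  have "\<bar>h * x m\<bar> \<le> \<bar>h\<bar>"
    using abs_coord_le_1[OF assms(1,2)] by (simp add: abs_mult mult_left_le)
  moreover have "(1 - \<bar>h\<bar>)\<^sup>2 > 0"
    using assms(3) by simp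
  ultimately have pos: "?r > 0"
    by (simp add: power2_eq_square algebra_simps abs_if split: if_splits)
  have "dot n ?y ?y = dot n ?y x + h * (x m + h)"
    by (subst dot_upd_add[OF assms(2)]) (simp add: dot_commute)
  also have "\<dots> = ?r"
    using assms(1) unfolding dot_upd_add[OF assms(2)]
    by (simp add: unit_vec_def power2_eq_square algebra_simps)
  finally have "dot n ?y ?y = ?r" .
  then show ?thesis
    using pos
    by (simp add: unit_vec_def tangent_curve_def dot_divide_left dot_divide_right del: fun_upd_apply)
qed

abbreviation has_tangential_deriv :: "nat \<Rightarrow> (vec \<Rightarrow> real) \<Rightarrow> real \<Rightarrow> vec \<Rightarrow> bool" where
  "has_tangential_deriv m f D x \<equiv>
     ((\<lambda>h. f (tangent_curve m x h)) has_real_derivative D) (at 0)"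

lemma DERIV_divide_sqrt_at_0:
  fixes a b c :: real
  shows "((\<lambda>h. (a + h * b) / sqrt (1 + 2 * h * c + h\<^sup>2)) has_real_derivative (b - c * a)) (at 0)"
  by (auto intro!: derivative_eq_intros)

lemma has_tangential_deriv_coord:
  "has_tangential_deriv m (\<lambda>x. x i) ((if i = m then 1 else 0) - x m * x i) x"
proof -
  have "(x(m := x m + h)) i = x i + h * (if i = m then 1 else 0)" for h
    by simp
  then show ?thesis
    by (simp only: tangent_curve_def DERIV_divide_sqrt_at_0)
qed

lemma has_tangential_deriv_dot:
  assumes "m < n"
  shows "has_tangential_deriv m (\<lambda>x. dot n x y) (y m - x m * dot n x y) x"
  by (simp only: tangent_curve_def dot_divide_left dot_upd_add[OF assms] DERIV_divide_sqrt_at_0)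

lemma has_tangential_deriv_poly_dot:
  assumes "m < n"
  shows "has_tangential_deriv m (\<lambda>x. poly p (dot n x y))
    (poly (pderiv p) (dot n x y) * (y m - x m * dot n x y)) x"
  using DERIV_chain2[OF poly_DERIV has_tangential_deriv_dot[OF assms]] by simp

lemma tangential_deriv_unique:
  assumes "unit_vec n x" "m < n"
    and eq: "\<And>z. unit_vec n z \<Longrightarrow> f z = g z"
    and f: "has_tangential_deriv m f D x" and g: "has_tangential_deriv m g E x"
  shows "D = E"
proof -
  have "has_tangential_deriv m g D x"
    by (rule has_field_derivative_transform_within[OF f zero_less_one])
      (use assms(1,2) in \<open>auto intro!: eq unit_vec_tangent_curve\<close>)
  then show ?thesis
    using g by (rule DERIV_unique)
qed

inductive polyfun :: "(vec \<Rightarrow> real) \<Rightarrow> bool" where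
  const: "polyfun (\<lambda>x. c)"
| coord: "polyfun (\<lambda>x. x i)"
| add: "polyfun f \<Longrightarrow> polyfun g \<Longrightarrow> polyfun (\<lambda>x. f x + g x)"
| mult: "polyfun f \<Longrightarrow> polyfun g \<Longrightarrow> polyfun (\<lambda>x. f x * g x)"

lemma polyfun_diff:
  assumes "polyfun f" "polyfun g"
  shows "polyfun (\<lambda>x. f x - g x)"
  using polyfun.add[OF assms(1) polyfun.mult[OF polyfun.const[of "-1"] assms(2)]] by simp

lemma polyfun_has_tangential_deriv:
  assumes "polyfun f"
  shows "\<exists>f'. polyfun f' \<and> (\<forall>x. has_tangential_deriv m f (f' x) x)"
  using assms
proof (induction rule: polyfun.induct)
  case (const c)
  show ?case
    by (rule exI[of _ "\<lambda>x. 0"]) (auto intro: polyfun.const)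
next
  case (coord i)
  have "polyfun (\<lambda>x. (if i = m then 1 else 0) - x m * x i)"
    by (intro polyfun_diff polyfun.intros)
  then show ?case
    using has_tangential_deriv_coord by blast
next
  case (add f g)
  then obtain f' g' where "polyfun f'" "polyfun g'"
    and "\<And>x. has_tangential_deriv m f (f' x) x" "\<And>x. has_tangential_deriv m g (g' x) x"
    by blast
  then show ?case
    by (intro exI[of _ "\<lambda>x. f' x + g' x"]) (auto intro!: polyfun.add DERIV_add)
next
  case (mult f g)
  then obtain f' g' where "polyfun f'" "polyfun g'"
    and deriv: "\<And>x. has_tangential_deriv m f (f' x) x" "\<And>x. has_tangential_deriv m g (g' x) x"
    by blast
  moreover have "has_tangential_deriv m (\<lambda>x. f x * g x) (f' x * g x + g' x * f x) x" for x
    using DERIV_mult[OF deriv] by simp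
  ultimately show ?case
    using mult.hyps
    by (intro exI[of _ "\<lambda>x. f' x * g x + g' x * f x"]) (auto intro!: polyfun.intros)
qed

inductive gram_kernel :: "kernel \<Rightarrow> bool" where
  square: "polyfun f \<Longrightarrow> gram_kernel (\<lambda>x y. f x * f y)"
| add: "gram_kernel K \<Longrightarrow> gram_kernel L \<Longrightarrow> gram_kernel (\<lambda>x y. K x y + L x y)"

lemma gram_kernel_const:
  assumes "c \<ge> 0"
  shows "gram_kernel (\<lambda>x y. c)"
  using gram_kernel.square[OF polyfun.const[of "sqrt c"]] assms by simp

lemma gram_kernel_square_mult:
  assumes "gram_kernel L" "polyfun f"
  shows "gram_kernel (\<lambda>x y. f x * f y * L x y)"
  using assms
proof (induction rule: gram_kernel.induct)
  case (square g)
  then show ?case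
    using gram_kernel.square[OF polyfun.mult[of f g]] by (simp add: mult_ac)
qed (simp add: distrib_left gram_kernel.add)

lemma gram_kernel_mult:
  assumes "gram_kernel K" "gram_kernel L"
  shows "gram_kernel (\<lambda>x y. K x y * L x y)"
  using assms
  by (induction rule: gram_kernel.induct)
    (simp_all add: gram_kernel_square_mult distrib_right gram_kernel.add)

lemma gram_kernel_sum:
  assumes "\<And>m. m \<in> A \<Longrightarrow> gram_kernel (K m)"
  shows "gram_kernel (\<lambda>x y. \<Sum>m\<in>A. K m x y)"
  using assms
  by (induction A rule: infinite_finite_induct) (auto intro: gram_kernel.add gram_kernel_const)

lemma gram_kernel_sum_nonneg:
  assumes "gram_kernel K"
  shows "(\<Sum>i\<in>I. \<Sum>j\<in>I. K (x i) (x j)) \<ge> 0"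
  using assms
proof (induction rule: gram_kernel.induct)
  case (square f)
  show ?case
    by (simp add: sum_product[symmetric])
qed (simp add: sum.distrib)

definition kernel_tangential_derivs ::
  "nat \<Rightarrow> kernel \<Rightarrow> kernel \<Rightarrow> kernel \<Rightarrow> bool" where
  "kernel_tangential_derivs m K K1 K2 \<longleftrightarrow>
     (\<forall>x y. has_tangential_deriv m (\<lambda>x. K x y) (K1 x y) x) \<and>
     (\<forall>x y. has_tangential_deriv m (\<lambda>y. K1 x y) (K2 x y) y)"

text \<open>For a symmetric kernel with these derivatives, this is the operator \<open>a x\<^sub>m - \<partial>\<^sub>m\<close>, where
  \<open>\<partial>\<^sub>m\<close> is the tangential derivative, applied in both arguments.\<close>

definition raised_kernel ::
  "nat \<Rightarrow> real \<Rightarrow> kernel \<Rightarrow> kernel \<Rightarrow> kernel \<Rightarrow> kernel" where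
  "raised_kernel m a K K1 K2 x y =
     a\<^sup>2 * (x m * y m) * K x y - a * (x m * K1 y x + y m * K1 x y) + K2 x y"

lemma gram_kernel_raise:
  assumes "gram_kernel K"
  shows "\<exists>K1 K2. kernel_tangential_derivs m K K1 K2 \<and> gram_kernel (raised_kernel m a K K1 K2)"
  using assms
proof (induction rule: gram_kernel.induct)
  case (square f)
  then obtain f' where f': "polyfun f'" "\<And>x. has_tangential_deriv m f (f' x) x"
    using polyfun_has_tangential_deriv by blast
  let ?K1 = "\<lambda>x y. f' x * f y" and ?K2 = "\<lambda>x y. f' x * f' y"
  have "raised_kernel m a (\<lambda>x y. f x * f y) ?K1 ?K2
      = (\<lambda>x y. (a * x m * f x - f' x) * (a * y m * f y - f' y))"
    by (intro ext) (simp add: raised_kernel_def power2_eq_square algebra_simps)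
  moreover have "gram_kernel (\<lambda>x y. (a * x m * f x - f' x) * (a * y m * f y - f' y))"
    by (intro gram_kernel.square polyfun_diff polyfun.intros square f')
  moreover have "kernel_tangential_derivs m (\<lambda>x y. f x * f y) ?K1 ?K2"
    unfolding kernel_tangential_derivs_def
    by (intro conjI allI DERIV_cmult DERIV_cmult_right f')
  ultimately show ?case
    by (intro exI[of _ ?K1] exI[of _ ?K2]) simp
next
  case (add K L)
  then obtain K1 K2 L1 L2 where
    derivs: "kernel_tangential_derivs m K K1 K2" "kernel_tangential_derivs m L L1 L2" and
    gram: "gram_kernel (raised_kernel m a K K1 K2)" "gram_kernel (raised_kernel m a L L1 L2)"
    by blast
  let ?M1 = "\<lambda>x y. K1 x y + L1 x y" and ?M2 = "\<lambda>x y. K2 x y + L2 x y"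
  have "raised_kernel m a (\<lambda>x y. K x y + L x y) ?M1 ?M2
      = (\<lambda>x y. raised_kernel m a K K1 K2 x y + raised_kernel m a L L1 L2 x y)"
    by (intro ext) (simp add: raised_kernel_def algebra_simps)
  moreover have "kernel_tangential_derivs m (\<lambda>x y. K x y + L x y) ?M1 ?M2"
    using derivs unfolding kernel_tangential_derivs_def by (intro conjI allI DERIV_add) blast+
  ultimately show ?case
    using gram_kernel.add[OF gram] by (intro exI[of _ ?M1] exI[of _ ?M2]) simp
qed

definition zonal_on_sphere :: "nat \<Rightarrow> kernel \<Rightarrow> real poly \<Rightarrow> bool" where
  "zonal_on_sphere n K p \<longleftrightarrow>
     (\<forall>x y. unit_vec n x \<longrightarrow> unit_vec n y \<longrightarrow> K x y = poly p (dot n x y))"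

lemma zonal_on_sphereD:
  "zonal_on_sphere n K p \<Longrightarrow> unit_vec n x \<Longrightarrow> unit_vec n y \<Longrightarrow> K x y = poly p (dot n x y)"
  by (simp add: zonal_on_sphere_def)

definition zonal_posdef :: "nat \<Rightarrow> real poly \<Rightarrow> bool" where
  "zonal_posdef n p \<longleftrightarrow> (\<exists>K. gram_kernel K \<and> zonal_on_sphere n K p)"

lemma zonal_posdefI: "gram_kernel K \<Longrightarrow> zonal_on_sphere n K p \<Longrightarrow> zonal_posdef n p"
  unfolding zonal_posdef_def by blast

lemma zonal_posdefE:
  assumes "zonal_posdef n p"
  obtains K where "gram_kernel K" "zonal_on_sphere n K p"
  using assms unfolding zonal_posdef_def by blast

lemma zonal_posdef_const:
  assumes "c \<ge> 0"
  shows "zonal_posdef n [:c:]"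
  by (rule zonal_posdefI[OF gram_kernel_const[OF assms]]) (simp add: zonal_on_sphere_def)

lemma zonal_posdef_add:
  assumes "zonal_posdef n p" "zonal_posdef n q"
  shows "zonal_posdef n (p + q)"
proof -
  obtain K L where "gram_kernel K" "zonal_on_sphere n K p" "gram_kernel L" "zonal_on_sphere n L q"
    using assms by (elim zonal_posdefE)
  then show ?thesis
    by (intro zonal_posdefI[of "\<lambda>x y. K x y + L x y"] gram_kernel.add)
      (auto simp: zonal_on_sphere_def)
qed

lemma zonal_posdef_mult:
  assumes "zonal_posdef n p" "zonal_posdef n q"
  shows "zonal_posdef n (p * q)"
proof -
  obtain K L where "gram_kernel K" "zonal_on_sphere n K p" "gram_kernel L" "zonal_on_sphere n L q"
    using assms by (elim zonal_posdefE)
  then show ?thesis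
    by (intro zonal_posdefI[of "\<lambda>x y. K x y * L x y"] gram_kernel_mult)
      (auto simp: zonal_on_sphere_def)
qed

lemma zonal_posdef_smult:
  assumes "zonal_posdef n p" "c \<ge> 0"
  shows "zonal_posdef n (smult c p)"
  using zonal_posdef_mult[OF zonal_posdef_const[OF assms(2)] assms(1)] by simp

lemma zonal_posdef_sum:
  assumes "\<And>a. a \<in> A \<Longrightarrow> zonal_posdef n (p a)"
  shows "zonal_posdef n (\<Sum>a\<in>A. p a)"
  using assms
  by (induction A rule: infinite_finite_induct)
    (auto intro: zonal_posdef_add simp: zonal_posdef_const[of 0, simplified])

lemma zonal_posdef_sum_nonneg:
  assumes "zonal_posdef n p" "\<And>i. i \<in> I \<Longrightarrow> unit_vec n (x i)"
  shows "(\<Sum>i\<in>I. \<Sum>j\<in>I. poly p (dot n (x i) (x j))) \<ge> 0"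
proof -
  obtain K where "gram_kernel K" and zonal: "zonal_on_sphere n K p"
    using assms(1) by (rule zonal_posdefE)
  then have "(\<Sum>i\<in>I. \<Sum>j\<in>I. K (x i) (x j)) \<ge> 0"
    by (simp add: gram_kernel_sum_nonneg)
  then show ?thesis
    by (simp add: zonal_on_sphereD[OF zonal] assms(2) cong: sum.cong)
qed

lemma zonal_tangential_derivs:
  assumes "m < n"
    and zonal: "zonal_on_sphere n K p"
    and derivs: "kernel_tangential_derivs m K K1 K2"
    and x: "unit_vec n x" and y: "unit_vec n y"
  shows "K1 x y = poly (pderiv p) (dot n x y) * (y m - x m * dot n x y)" (is ?first)
    and "K2 x y = poly (pderiv (pderiv p)) (dot n x y)
        * ((y m - x m * dot n x y) * (x m - y m * dot n x y))
      + poly (pderiv p) (dot n x y) * (1 - x m * x m - y m * (y m - x m * dot n x y))"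
    (is ?second)
proof -
  have K1: "has_tangential_deriv m (\<lambda>x. K x y) (K1 x y) x"
    and K2: "has_tangential_deriv m (\<lambda>y. K1 x y) (K2 x y) y" for x y
    using derivs unfolding kernel_tangential_derivs_def by blast+
  have first: "K1 x z = poly (pderiv p) (dot n z x) * (z m - x m * dot n z x)"
    if "unit_vec n z" for z
    unfolding dot_commute[of n z]
    by (rule tangential_deriv_unique[OF x assms(1) _ K1 has_tangential_deriv_poly_dot[OF assms(1)]])
      (rule zonal_on_sphereD[OF zonal _ that])
  show ?first
    using first[OF y] by (simp add: dot_commute[of n y])
  have "has_tangential_deriv m (\<lambda>z. poly (pderiv p) (dot n z x) * (z m - x m * dot n z x))
      (poly (pderiv (pderiv p)) (dot n y x) * (x m - y m * dot n y x) * (y m - x m * dot n y x)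
       + (1 - y m * y m - x m * (x m - y m * dot n y x)) * poly (pderiv p) (dot n y x)) y"
    using DERIV_mult[OF has_tangential_deriv_poly_dot[OF assms(1)]
        DERIV_diff[OF has_tangential_deriv_coord[where m = m and i = m]
          DERIV_cmult[OF has_tangential_deriv_dot[OF assms(1)]]]]
    by simp
  from tangential_deriv_unique[OF y assms(1) first K2 this] show ?second
    by (simp add: dot_commute[of n y] algebra_simps)
qed

lemma raised_kernel_zonal:
  assumes "m < n"
    and zonal: "zonal_on_sphere n K p"
    and derivs: "kernel_tangential_derivs m K K1 K2"
    and unit: "unit_vec n x" "unit_vec n y"
  defines "t \<equiv> dot n x y"
  defines "p0 \<equiv> poly p t" and "p1 \<equiv> poly (pderiv p) t" and "p2 \<equiv> poly (pderiv (pderiv p)) t"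
  shows "raised_kernel m a K K1 K2 x y = p1
    + (a\<^sup>2 * p0 + 2 * a * t * p1 + (1 + t\<^sup>2) * p2 + t * p1) * (x m * y m)
    - (a * p1 + t * p2 + p1) * (x m * x m + y m * y m)"
proof -
  note derivs = zonal_tangential_derivs[OF assms(1) zonal derivs]
  have "raised_kernel m a K K1 K2 x y = a\<^sup>2 * (x m * y m) * p0
      - a * (x m * (p1 * (x m - y m * t)) + y m * (p1 * (y m - x m * t)))
      + (p2 * ((y m - x m * t) * (x m - y m * t)) + p1 * (1 - x m * x m - y m * (y m - x m * t)))"
    unfolding raised_kernel_def zonal_on_sphereD[OF zonal unit] derivs(2)[OF unit]
      derivs(1)[OF unit] derivs(1)[OF unit(2,1)] dot_commute[of n y x]
    by (simp only: t_def p0_def p1_def p2_def)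
  then show ?thesis
    by (simp add: power2_eq_square algebra_simps)
qed

text \<open>If \<open>f\<close> is the restriction of a harmonic polynomial of degree \<open>k\<close>, then for \<open>a = k + n - 2\<close>
  the function \<open>a x\<^sub>m f - \<partial>\<^sub>m f\<close> is a multiple of the harmonic part of \<open>x\<^sub>m f\<close> of degree \<open>k + 1\<close>. So
  this operator, summed over \<open>m\<close>, maps the zonal kernel of degree \<open>k\<close> to that of degree \<open>k + 1\<close>.\<close>

lemma zonal_posdef_raise:
  assumes "zonal_posdef n p"
  shows "zonal_posdef n (smult (a\<^sup>2) ([:0, 1:] * p) - smult (2 * a) ([:1, 0, -1:] * pderiv p)
    - [:0, 1:] * [:1, 0, -1:] * pderiv (pderiv p) + [:real n - 2, 0, 1:] * pderiv p)"
    (is "zonal_posdef n ?q")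
proof -
  obtain K where "gram_kernel K" and zonal: "zonal_on_sphere n K p"
    using assms by (rule zonal_posdefE)
  then have "\<forall>m. \<exists>K1 K2. kernel_tangential_derivs m K K1 K2 \<and>
      gram_kernel (raised_kernel m a K K1 K2)"
    using gram_kernel_raise by blast
  then obtain K1 K2 where derivs: "\<And>m. kernel_tangential_derivs m K (K1 m) (K2 m)"
    and gram: "\<And>m. gram_kernel (raised_kernel m a K (K1 m) (K2 m))"
    unfolding choice_iff by blast
  have "(\<Sum>m<n. raised_kernel m a K (K1 m) (K2 m) x y) = poly ?q (dot n x y)"
    if unit: "unit_vec n x" "unit_vec n y" for x y
  proof -
    define t p0 p1 p2 where "t = dot n x y" and "p0 = poly p t" and "p1 = poly (pderiv p) t"
      and "p2 = poly (pderiv (pderiv p)) t"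
    have "(\<Sum>m<n. raised_kernel m a K (K1 m) (K2 m) x y) = (\<Sum>m<n. p1
        + (a\<^sup>2 * p0 + 2 * a * t * p1 + (1 + t\<^sup>2) * p2 + t * p1) * (x m * y m)
        - (a * p1 + t * p2 + p1) * (x m * x m + y m * y m))"
      unfolding t_def p0_def p1_def p2_def
      by (intro sum.cong refl raised_kernel_zonal zonal derivs unit) auto
    also have "\<dots> = n * p1 + (a\<^sup>2 * p0 + 2 * a * t * p1 + (1 + t\<^sup>2) * p2 + t * p1) * t
        - (a * p1 + t * p2 + p1) * (1 + 1)"
      using unit unfolding unit_vec_def dot_def t_def
      by (simp add: sum.distrib sum_subtractf flip: sum_distrib_left)
    also have "\<dots> = poly ?q t"
      by (simp add: p0_def p1_def p2_def power2_eq_square algebra_simps)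
    finally show ?thesis
      by (simp only: t_def)
  qed
  moreover have "gram_kernel (\<lambda>x y. \<Sum>m<n. raised_kernel m a K (K1 m) (K2 m) x y)"
    by (intro gram_kernel_sum gram)
  ultimately show ?thesis
    by (intro zonal_posdefI) (auto simp only: zonal_on_sphere_def)
qed

section \<open>Gegenbauer polynomials\<close>

text \<open>The parameter \<open>v\<close> is the dimension of the ambient space minus 2, that is \<open>2\<lambda>\<close> in the usual
  notation for Gegenbauer polynomials; \<open>geg v k\<close> is normalised to be monic.\<close>

definition geg_beta :: "nat \<Rightarrow> nat \<Rightarrow> real" where
  "geg_beta v k =
     real k * (real k + real v - 1) / ((2 * real k + real v) * (2 * real k + real v - 2))"

fun geg :: "nat \<Rightarrow> nat \<Rightarrow> real poly" where
  "geg v 0 = 1"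
| "geg v (Suc 0) = [:0, 1:]"
| "geg v (Suc (Suc k)) = [:0, 1:] * geg v (Suc k) - smult (geg_beta v (Suc k)) (geg v k)"

lemma geg_beta_Suc:
  "geg_beta v (Suc k) = (real k + 1) * (real k + v) / ((2 * real k + 2 + v) * (2 * real k + v))"
  by (simp add: geg_beta_def algebra_simps)

lemma geg_beta_Suc_nonneg: "geg_beta v (Suc k) \<ge> 0"
  by (simp add: geg_beta_Suc)

lemma geg_beta_Suc_pos:
  assumes "v \<ge> 1"
  shows "geg_beta v (Suc k) > 0"
  using assms by (auto simp: geg_beta_Suc intro!: divide_pos_pos mult_pos_pos)

lemma geg_beta_le_Suc:
  assumes "v \<ge> 2"
  shows "geg_beta v k \<le> geg_beta v (Suc k)"
proof (cases k)
  case 0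
  then show ?thesis
    using assms by (simp add: geg_beta_def)
next
  case (Suc l)
  define L V where "L = real l" and "V = real v - 2"
  have nonneg: "L \<ge> 0" "V \<ge> 0"
    using assms by (simp_all add: L_def V_def)
  have v: "real v = V + 2"
    by (simp add: V_def)
  have "0 \<le> V\<^sup>2 + 2 * V"
    using nonneg by simp
  then have "(L + 1) * (L + V + 2) * (2 * L + V + 6) \<le> (L + 2) * (L + V + 3) * (2 * L + V + 2)"
    by (simp add: power2_eq_square algebra_simps)
  then have "(L + 1) * (L + V + 2) / (2 * L + V + 2) \<le> (L + 2) * (L + V + 3) / (2 * L + V + 6)"
    using nonneg by (simp add: divide_simps)
  then have "(L + 1) * (L + V + 2) / (2 * L + V + 2) / (2 * L + V + 4)
      \<le> (L + 2) * (L + V + 3) / (2 * L + V + 6) / (2 * L + V + 4)"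
    using nonneg by (intro divide_right_mono) auto
  then show ?thesis
    unfolding Suc geg_beta_Suc v by (simp add: L_def algebra_simps)
qed

lemma mono_geg_beta: "v \<ge> 2 \<Longrightarrow> mono (geg_beta v)"
  by (simp add: mono_iff_le_Suc geg_beta_le_Suc)

lemma pderiv_X: "pderiv [:0, 1:] = 1"
  by (simp add: pderiv_pCons)

lemma geg_recurrence:
  assumes "v \<ge> 1"
  shows "(2 * real k + 2 + v) * (2 * real k + v) * poly (geg v (Suc (Suc k))) t
     = (2 * real k + 2 + v) * (2 * real k + v) * t * poly (geg v (Suc k)) t
       - (real k + 1) * (real k + v) * poly (geg v k) t" (is ?values)
    and "(2 * real k + 2 + v) * (2 * real k + v) * poly (pderiv (geg v (Suc (Suc k)))) t
     = (2 * real k + 2 + v) * (2 * real k + v)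
         * (poly (geg v (Suc k)) t + t * poly (pderiv (geg v (Suc k))) t)
       - (real k + 1) * (real k + v) * poly (pderiv (geg v k)) t" (is ?derivs)
proof -
  have "2 * real k + 2 + v \<noteq> 0" "2 * real k + v \<noteq> 0"
    using assms by linarith+
  then have beta: "(real k + 1) * (real k + v)
      = geg_beta v (Suc k) * ((2 * real k + 2 + v) * (2 * real k + v))"
    by (simp add: geg_beta_Suc)
  show ?values
    unfolding beta by (simp add: algebra_simps)
  show ?derivs
    unfolding beta geg.simps pderiv_diff pderiv_mult pderiv_smult pderiv_X
    by (simp add: algebra_simps)
qed

lemma three_term_pderiv_step:
  fixes K V t q0 q1 q2 d0 d1 d2 :: real
  assumes nonzero: "2 * K + V \<noteq> 0"
    and rec: "(2 * K + 2 + V) * (2 * K + V) * q2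
      = (2 * K + 2 + V) * (2 * K + V) * t * q1 - (K + 1) * (K + V) * q0"
    and rec_deriv: "(2 * K + 2 + V) * (2 * K + V) * d2
      = (2 * K + 2 + V) * (2 * K + V) * (q1 + t * d1) - (K + 1) * (K + V) * d0"
    and lower: "(1 - t\<^sup>2) * d0 = (K + V) * t * q0 - (2 * K + V) * q1"
    and raise: "(2 * K + V) * d1 = (K + 1) * (t * d0 + (K + V) * q0)"
  shows "(1 - t\<^sup>2) * d1 = (K + 1 + V) * t * q1 - (2 * K + 2 + V) * q2" (is ?lower)
    and "(2 * K + 2 + V) * d2 = (K + 2) * (t * d1 + (K + 1 + V) * q1)" (is ?raise)
proof -
  have "(2 * K + V) * ((1 - t\<^sup>2) * d1)
      = (2 * K + V) * ((K + 1 + V) * t * q1 - (2 * K + 2 + V) * q2)"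
    using lower raise rec by algebra
  then show ?lower
    using nonzero by simp
  have "(2 * K + V) * t * d1 - (K + 1) * d0 = (2 * K + V) * (K + 1) * q1"
    using lower raise by algebra
  then have "(2 * K + V) * ((2 * K + 2 + V) * d2)
      = (2 * K + V) * ((K + 2) * (t * d1 + (K + 1 + V) * q1))"
    using rec_deriv by algebra
  then show ?raise
    using nonzero by simp
qed

lemma
  assumes "v \<ge> 1"
  shows geg_pderiv: "(1 - t\<^sup>2) * poly (pderiv (geg v k)) t
      = (real k + v) * t * poly (geg v k) t - (2 * real k + v) * poly (geg v (Suc k)) t"
    and geg_pderiv_Suc: "(2 * real k + v) * poly (pderiv (geg v (Suc k))) t
      = (real k + 1) * (t * poly (pderiv (geg v k)) t + (real k + v) * poly (geg v k) t)"
proof (induction k)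
  case 0
  case 1
  show ?case by (simp add: pderiv_pCons)
next
  case 0
  case 2
  show ?case by (simp add: pderiv_pCons)
next
  case (Suc k)
  have "2 * real k + v \<noteq> 0"
    using assms by simp
  note pderiv_step = three_term_pderiv_step[OF this geg_recurrence[OF assms] Suc.IH]
  {
    case 1
    show ?case using pderiv_step(1) by (simp add: add_ac del: geg.simps)
  next
    case 2
    show ?case using pderiv_step(2) by (simp add: add_ac del: geg.simps)
  }
qed

lemma geg_ode:
  assumes "v \<ge> 1"
  shows "(1 - t\<^sup>2) * poly (pderiv (pderiv (geg v k))) t
      = (real v + 1) * t * poly (pderiv (geg v k)) t - real k * (real k + v) * poly (geg v k) t"
proof -
  have "[:1, 0, -1:] * pderiv (geg v k)
      = smult (real k + v) ([:0, 1:] * geg v k) - smult (2 * real k + v) (geg v (Suc k))"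
    unfolding poly_eq_poly_eq_iff[symmetric] fun_eq_iff
    using geg_pderiv[OF assms] by (simp add: power2_eq_square algebra_simps)
  then have deriv_eq: "poly (pderiv ([:1, 0, -1:] * pderiv (geg v k))) t = poly (pderiv
      (smult (real k + v) ([:0, 1:] * geg v k) - smult (2 * real k + v) (geg v (Suc k)))) t"
    by simp
  have pderiv_factor: "pderiv [:1, 0, -1::real:] = [:0, -2:]"
    by (simp add: pderiv_pCons)
  have "(1 - t\<^sup>2) * poly (pderiv (pderiv (geg v k))) t - 2 * t * poly (pderiv (geg v k)) t
     = (real k + v) * (poly (geg v k) t + t * poly (pderiv (geg v k)) t)
       - (2 * real k + v) * poly (pderiv (geg v (Suc k))) t"
    using deriv_eq unfolding pderiv_diff pderiv_mult pderiv_smult pderiv_X pderiv_factor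
    by (simp add: power2_eq_square algebra_simps)
  then show ?thesis
    unfolding geg_pderiv_Suc[OF assms] by algebra
qed

lemma zonal_posdef_geg:
  assumes "v \<ge> 1"
  shows "zonal_posdef (v + 2) (geg v k)"
proof (induction k)
  case 0
  show ?case
    using zonal_posdef_const[of 1] by (simp add: one_pCons)
next
  case (Suc k)
  define a c where "a = real k + v" and "c = (2 * real k + v)\<^sup>2"
  have c: "c > 0"
    using assms by (simp add: c_def)
  let ?q = "smult (a\<^sup>2) ([:0, 1:] * geg v k) - smult (2 * a) ([:1, 0, -1:] * pderiv (geg v k))
    - [:0, 1:] * [:1, 0, -1:] * pderiv (pderiv (geg v k))
    + [:real (v + 2) - 2, 0, 1:] * pderiv (geg v k)"
  have "?q = smult c (geg v (Suc k))"
    unfolding poly_eq_poly_eq_iff[symmetric] fun_eq_iff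
  proof
    fix t
    define p0 p1 p2 where "p0 = poly (geg v k) t" and "p1 = poly (pderiv (geg v k)) t"
      and "p2 = poly (pderiv (pderiv (geg v k))) t"
    have "poly ?q t
        = a\<^sup>2 * t * p0 - 2 * a * ((1 - t\<^sup>2) * p1) - t * ((1 - t\<^sup>2) * p2) + (v + t\<^sup>2) * p1"
      by (simp add: p0_def p1_def p2_def power2_eq_square algebra_simps)
    also have "\<dots> = (2 * real k + v) * (a * t * p0 - (1 - t\<^sup>2) * p1)"
      unfolding p2_def geg_ode[OF assms] a_def p0_def p1_def by algebra
    also have "\<dots> = poly (smult c (geg v (Suc k))) t"
      unfolding p1_def geg_pderiv[OF assms] a_def c_def p0_def poly_smult by algebra
    finally show "poly ?q t = poly (smult c (geg v (Suc k))) t" .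
  qed
  then have "zonal_posdef (v + 2) (smult c (geg v (Suc k)))"
    using zonal_posdef_raise[OF Suc, of a] by simp
  from zonal_posdef_smult[OF this, of "inverse c"] c show ?case
    by simp
qed

lemma geg_at_1_Suc:
  assumes "v \<ge> 1"
  shows "poly (geg v (Suc k)) 1 = (real k + v) / (2 * real k + v) * poly (geg v k) 1"
proof -
  have "(2 * real k + v) * poly (geg v (Suc k)) 1 = (real k + v) * poly (geg v k) 1"
    using geg_pderiv[OF assms, of 1 k] by simp
  then show ?thesis
    using assms by (simp add: field_simps)
qed

lemma geg_at_1_pos:
  assumes "v \<ge> 1"
  shows "poly (geg v k) 1 > 0"
proof (induction k)
  case (Suc k)
  then show ?case
    using assms unfolding geg_at_1_Suc[OF assms] by (intro mult_pos_pos divide_pos_pos) auto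
qed simp

lemma geg_at_1_antimono:
  assumes "v \<ge> 1" "k \<le> l"
  shows "poly (geg v l) 1 \<le> poly (geg v k) 1"
  using assms(2)
proof (induction l rule: dec_induct)
  case (step l)
  have "(real l + v) / (2 * real l + v) \<le> 1"
    using assms(1) by simp
  then have "poly (geg v (Suc l)) 1 \<le> poly (geg v l) 1"
    unfolding geg_at_1_Suc[OF assms(1)] using geg_at_1_pos[OF assms(1), of l]
    by (intro mult_left_le_one_le) auto
  then show ?case
    using step.IH by linarith
qed simp

definition geg_sqnorm :: "nat \<Rightarrow> nat \<Rightarrow> real" where
  "geg_sqnorm v k = (\<Prod>i<k. geg_beta v (Suc i))"

lemma geg_sqnorm_Suc: "geg_sqnorm v (Suc k) = geg_sqnorm v k * geg_beta v (Suc k)"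
  by (simp add: geg_sqnorm_def)

lemma geg_sqnorm_pos:
  assumes "v \<ge> 1"
  shows "geg_sqnorm v k > 0"
  unfolding geg_sqnorm_def by (intro prod_pos geg_beta_Suc_pos[OF assms])

text \<open>Up to the factor \<open>(2 k + v) / v\<close>, the binomial coefficient is the dimension of the space of
  spherical harmonics of degree \<open>k\<close>.\<close>

lemma geg_at_1_square:
  assumes "v \<ge> 1"
  shows "(poly (geg v k) 1)\<^sup>2 * v
    = (2 * real k + v) * real ((k + v - 1) choose k) * geg_sqnorm v k"
proof (induction k)
  case 0
  show ?case by (simp add: geg_sqnorm_def)
next
  case (Suc k)
  define K V B where "K = real k" and "V = real v" and "B = real ((k + v - 1) choose k)"
  have pos: "2 * K + V > 0" "K \<ge> 0" "V > 0"
    using assms by (simp_all add: K_def V_def)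
  have "real (Suc k * ((Suc k + v - 1) choose Suc k)) = real ((k + v) * ((k + v - 1) choose k))"
    by (rule arg_cong[of _ _ real]) (use Suc_times_binomial[of k "k + v - 1"] assms in simp)
  then have "real (Suc k) * real ((Suc k + v - 1) choose Suc k) = real (k + v) * B"
    unfolding B_def of_nat_mult .
  then have binomial: "real ((Suc k + v - 1) choose Suc k) = (K + V) / (K + 1) * B"
    using pos by (simp add: K_def V_def field_simps)
  have "(poly (geg v (Suc k)) 1)\<^sup>2 * V = ((K + V) / (2 * K + V))\<^sup>2 * ((poly (geg v k) 1)\<^sup>2 * V)"
    unfolding geg_at_1_Suc[OF assms] power_mult_distrib by (simp add: K_def V_def)
  also have "\<dots> = ((K + V) / (2 * K + V))\<^sup>2 * ((2 * K + V) * B * geg_sqnorm v k)"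
    using Suc by (simp add: K_def V_def B_def)
  also have "\<dots> = (2 * K + 2 + V) * ((K + V) / (K + 1) * B)
      * (geg_sqnorm v k * ((K + 1) * (K + V) / ((2 * K + 2 + V) * (2 * K + V))))"
    using pos by (simp add: power2_eq_square divide_simps)
  also have "\<dots>
      = (2 * real (Suc k) + V) * real ((Suc k + v - 1) choose Suc k) * geg_sqnorm v (Suc k)"
    unfolding binomial geg_sqnorm_Suc geg_beta_Suc
    by (simp only: K_def V_def of_nat_Suc distrib_left mult_1_right add_ac)
  finally show ?case
    by (simp add: V_def)
qed

definition geg_turan :: "nat \<Rightarrow> nat \<Rightarrow> real poly" where
  "geg_turan v k = geg v (Suc k) * geg v (Suc k) - geg v k * geg v (Suc (Suc k))"

lemma geg_turan_Suc:
  "geg_turan v (Suc k)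
     = smult (geg_beta v (Suc (Suc k)) - geg_beta v (Suc k)) (geg v (Suc k) * geg v (Suc k))
       + smult (geg_beta v (Suc k)) (geg_turan v k)"
proof -
  define q0 q1 q2 where "q0 = geg v k" and "q1 = geg v (Suc k)" and "q2 = geg v (Suc (Suc k))"
  define b1 b2 where "b1 = geg_beta v (Suc k)" and "b2 = geg_beta v (Suc (Suc k))"
  have rec: "q2 = [:0, 1:] * q1 - smult b1 q0"
    "geg v (Suc (Suc (Suc k))) = [:0, 1:] * q2 - smult b2 q1"
    unfolding q0_def q1_def q2_def b1_def b2_def by (rule geg.simps)+
  have "geg_turan v (Suc k) = q2 * q2 - q1 * ([:0, 1:] * q2 - smult b2 q1)"
    unfolding geg_turan_def rec(2) by (simp only: q1_def q2_def)
  also have "\<dots> = q2 * ([:0, 1:] * q1 - smult b1 q0) - q1 * ([:0, 1:] * q2 - smult b2 q1)"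
    unfolding rec(1)[symmetric] ..
  also have "\<dots> = smult (b2 - b1) (q1 * q1) + smult b1 (q1 * q1 - q0 * q2)"
    by (simp add: algebra_simps smult_diff_left smult_diff_right)
  finally show ?thesis
    by (simp only: geg_turan_def q0_def q1_def q2_def b1_def b2_def)
qed

lemma zonal_posdef_geg_square_Suc:
  assumes "v \<ge> 1" and turan: "zonal_posdef (v + 2) (geg_turan v k - [:c:])"
  shows "zonal_posdef (v + 2) (geg v (Suc k) * geg v (Suc k) - [:c:])"
proof -
  have "zonal_posdef (v + 2) (geg_turan v k - [:c:] + geg v k * geg v (Suc (Suc k)))"
    by (intro zonal_posdef_add turan zonal_posdef_mult zonal_posdef_geg assms(1))
  also have "geg_turan v k - [:c:] + geg v k * geg v (Suc (Suc k))
      = geg v (Suc k) * geg v (Suc k) - [:c:]"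
    unfolding geg_turan_def by algebra
  finally show ?thesis .
qed

lemma zonal_posdef_geg_turan:
  assumes "v \<ge> 2"
  shows "zonal_posdef (v + 2) (geg_turan v k - [:geg_sqnorm v (Suc k):])"
proof (induction k)
  case 0
  have "geg_turan v 0 = [:geg_sqnorm v 1:]"
    by (simp add: geg_turan_def geg_sqnorm_def one_pCons)
  then show ?case
    using zonal_posdef_const[of 0] by simp
next
  case (Suc k)
  define b1 b2 where "b1 = geg_beta v (Suc k)" and "b2 = geg_beta v (Suc (Suc k))"
  have "b1 \<ge> 0" "b2 - b1 \<ge> 0"
    using geg_beta_Suc_nonneg geg_beta_le_Suc[OF assms] by (simp_all add: b1_def b2_def)
  then have "zonal_posdef (v + 2)
      (smult (b2 - b1) (geg v (Suc k) * geg v (Suc k) - [:geg_sqnorm v (Suc k):])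
        + smult b1 (geg_turan v k - [:geg_sqnorm v (Suc k):]))"
    using assms by (intro zonal_posdef_add zonal_posdef_smult zonal_posdef_geg_square_Suc Suc) auto
  also have "smult (b2 - b1) (geg v (Suc k) * geg v (Suc k) - [:geg_sqnorm v (Suc k):])
      + smult b1 (geg_turan v k - [:geg_sqnorm v (Suc k):])
      = geg_turan v (Suc k) - [:geg_sqnorm v (Suc (Suc k)):]"
    unfolding geg_turan_Suc b1_def[symmetric] b2_def[symmetric]
    by (simp add: geg_sqnorm_Suc b2_def smult_diff_right algebra_simps)
  finally show ?case .
qed

text \<open>Only the constant term of the expansion of \<open>q\<^sub>k\<^sup>2\<close> in Gegenbauer polynomials is needed; the
  Turan determinants yield it without linearisation coefficients.\<close>

lemma zonal_posdef_geg_square: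
  assumes "v \<ge> 2"
  shows "zonal_posdef (v + 2) (geg v k * geg v k - [:geg_sqnorm v k:])"
proof (cases k)
  case 0
  then show ?thesis
    using zonal_posdef_const[of 0] by (simp add: geg_sqnorm_def one_pCons)
next
  case (Suc l)
  show ?thesis
    unfolding Suc using assms by (intro zonal_posdef_geg_square_Suc zonal_posdef_geg_turan) auto
qed

section \<open>The linear programming bound\<close>

definition spherical_code :: "nat \<Rightarrow> real \<Rightarrow> 'a set \<Rightarrow> ('a \<Rightarrow> vec) \<Rightarrow> bool" where
  "spherical_code n s I x \<longleftrightarrow> finite I \<and> (\<forall>i\<in>I. unit_vec n (x i)) \<and>
     (\<forall>i\<in>I. \<forall>j\<in>I. i \<noteq> j \<longrightarrow> dot n (x i) (x j) \<le> s)"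

lemma delsarte_bound:
  assumes code: "spherical_code n s I x" and "I \<noteq> {}"
    and nonpos: "\<And>t. t \<le> s \<Longrightarrow> poly f t \<le> 0"
    and posdef: "zonal_posdef n (f - [:c:])"
  shows "real (card I) * c \<le> poly f 1"
proof -
  have I: "finite I" "\<And>i. i \<in> I \<Longrightarrow> unit_vec n (x i)"
    using code by (auto simp: spherical_code_def)
  have "0 \<le> (\<Sum>i\<in>I. \<Sum>j\<in>I. poly (f - [:c:]) (dot n (x i) (x j)))"
    by (rule zonal_posdef_sum_nonneg[OF posdef I(2)])
  also have "\<dots> = (\<Sum>i\<in>I. \<Sum>j\<in>I. poly f (dot n (x i) (x j))) - (real (card I))\<^sup>2 * c"
    by (simp add: sum_subtractf power2_eq_square)
  finally have "(real (card I))\<^sup>2 * c \<le> (\<Sum>i\<in>I. \<Sum>j\<in>I. poly f (dot n (x i) (x j)))"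
    by simp
  also have "\<dots> \<le> (\<Sum>i\<in>I. \<Sum>j\<in>I. if i = j then poly f 1 else 0)"
    using code by (intro sum_mono) (auto simp: spherical_code_def unit_vec_def intro: nonpos)
  also have "\<dots> = real (card I) * poly f 1"
    using I(1) by simp
  finally show ?thesis
    using assms(2) I(1) by (simp add: power2_eq_square mult.assoc card_gt_0_iff)
qed

definition geg_comb :: "nat \<Rightarrow> nat \<Rightarrow> nat \<Rightarrow> (nat \<Rightarrow> real) \<Rightarrow> real poly" where
  "geg_comb v b L w = (\<Sum>a<L. smult (w (Suc a)) (geg v (b + Suc a)))"

text \<open>The coefficient vector \<open>w\<close> lives on \<open>{1..L}\<close>, extended by zero at \<open>0\<close> and \<open>L + 1\<close>; the last
  condition says that the matrix of multiplication by \<open>t\<close> maps it to at least \<open>\<rho> w\<close>.\<close>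

definition geg_subeigenvector :: "nat \<Rightarrow> nat \<Rightarrow> nat \<Rightarrow> real \<Rightarrow> (nat \<Rightarrow> real) \<Rightarrow> bool" where
  "geg_subeigenvector v b L \<rho> w \<longleftrightarrow> w 0 = 0 \<and> w (Suc L) = 0 \<and> (\<forall>a\<le>L. w a \<ge> 0) \<and>
     (\<forall>a<L. \<rho> * w (Suc a) \<le> w a + geg_beta v (b + a + 2) * w (a + 2))"

lemma linear_mult_geg_comb:
  "[:- \<rho>, 1:] * geg_comb v b L w + smult (w 0) (geg v (Suc b))
      + smult (geg_beta v (Suc (b + L)) * w (Suc L)) (geg v (b + L))
    = smult (w L) (geg v (Suc (b + L))) + smult (geg_beta v (Suc b) * w 1) (geg v b)
      + (\<Sum>a<L. smult (w a + geg_beta v (b + a + 2) * w (a + 2) - \<rho> * w (Suc a))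
          (geg v (b + Suc a)))"
proof (induction L)
  case 0
  show ?case by (simp add: geg_comb_def)
next
  case (Suc L)
  define R where "R = [:- \<rho>, 1:]"
  have "R * geg v (Suc (b + L)) = geg v (Suc (Suc (b + L)))
      + smult (geg_beta v (Suc (b + L))) (geg v (b + L)) - smult \<rho> (geg v (Suc (b + L)))"
    by (simp add: R_def)
  then have "R * geg_comb v b (Suc L) w = R * geg_comb v b L w
      + smult (w (Suc L)) (geg v (Suc (Suc (b + L)))
        + smult (geg_beta v (Suc (b + L))) (geg v (b + L)) - smult \<rho> (geg v (Suc (b + L))))"
    by (simp add: geg_comb_def distrib_left del: geg.simps)
  then show ?case
    using Suc unfolding R_def[symmetric]
    by (simp add: geg_comb_def algebra_simps smult_add_left smult_diff_left smult_add_right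
        smult_diff_right del: geg.simps)
qed

lemma zonal_posdef_geg_comb:
  assumes "v \<ge> 1" "\<And>a. a < L \<Longrightarrow> w (Suc a) \<ge> 0"
  shows "zonal_posdef (v + 2) (geg_comb v b L w)"
  unfolding geg_comb_def using assms
  by (intro zonal_posdef_sum zonal_posdef_smult zonal_posdef_geg) auto

lemma zonal_posdef_linear_mult_geg_comb:
  assumes "v \<ge> 1" "L \<ge> 1" and w: "geg_subeigenvector v b L \<rho> w"
  shows "zonal_posdef (v + 2) ([:- \<rho>, 1:] * geg_comb v b L w)"
proof -
  let ?r = "\<Sum>a<L. smult (w a + geg_beta v (b + a + 2) * w (a + 2) - \<rho> * w (Suc a))
    (geg v (b + Suc a))"
  have "zonal_posdef (v + 2)
      (smult (w L) (geg v (Suc (b + L))) + smult (geg_beta v (Suc b) * w 1) (geg v b) + ?r)"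
    using w assms(1,2) geg_beta_Suc_nonneg[of v b]
    by (intro zonal_posdef_add zonal_posdef_sum zonal_posdef_smult zonal_posdef_geg)
      (auto simp: geg_subeigenvector_def)
  then show ?thesis
    using linear_mult_geg_comb[of \<rho> v b L w] w
    by (simp add: geg_subeigenvector_def del: mult_pCons_left)
qed

lemma zonal_posdef_geg_comb_square:
  assumes "v \<ge> 2" "L \<ge> 1" and nonneg: "\<And>a. a < L \<Longrightarrow> w (Suc a) \<ge> 0"
  shows "zonal_posdef (v + 2)
    (geg_comb v b L w * geg_comb v b L w - [:(w 1)\<^sup>2 * geg_sqnorm v (Suc b):])"
proof -
  obtain M where L: "L = Suc M"
    using assms(2) by (cases L) auto
  define g q r where "g = geg_comb v b L w" and "q = geg v (Suc b)"
    and "r = (\<Sum>a<M. smult (w (Suc (Suc a))) (geg v (b + Suc (Suc a))))"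
  have g: "g = smult (w 1) q + r"
    unfolding g_def geg_comb_def L sum.lessThan_Suc_shift by (simp add: q_def r_def)
  have r: "zonal_posdef (v + 2) r"
    unfolding r_def using assms
    by (intro zonal_posdef_sum zonal_posdef_smult zonal_posdef_geg) (auto simp: L)
  have "zonal_posdef (v + 2)
      (smult ((w 1)\<^sup>2) (q * q - [:geg_sqnorm v (Suc b):]) + smult (w 1) (q * r) + r * g)"
    unfolding g_def q_def using assms nonneg[of 0]
    by (intro zonal_posdef_add zonal_posdef_smult zonal_posdef_mult r zonal_posdef_geg
        zonal_posdef_geg_square zonal_posdef_geg_comb) auto
  also have "smult ((w 1)\<^sup>2) (q * q - [:geg_sqnorm v (Suc b):]) + smult (w 1) (q * r) + r * g
      = g * g - [:(w 1)\<^sup>2 * geg_sqnorm v (Suc b):]"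
    unfolding g by (simp add: algebra_simps smult_add_right smult_diff_right power2_eq_square)
  finally show ?thesis
    by (simp only: g_def)
qed

lemma geg_comb_at_1:
  assumes "v \<ge> 1" and nonneg: "\<And>a. a < L \<Longrightarrow> w (Suc a) \<ge> 0"
  shows "0 \<le> poly (geg_comb v b L w) 1"
    and "poly (geg_comb v b L w) 1 \<le> (\<Sum>a<L. w (Suc a)) * poly (geg v (Suc b)) 1"
proof -
  show "0 \<le> poly (geg_comb v b L w) 1"
    using assms less_imp_le[OF geg_at_1_pos[OF assms(1)]]
    by (auto simp: geg_comb_def poly_sum intro!: sum_nonneg)
  have "poly (geg_comb v b L w) 1 \<le> (\<Sum>a<L. w (Suc a) * poly (geg v (Suc b)) 1)"
    unfolding geg_comb_def poly_sum poly_smult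
    using assms by (intro sum_mono mult_left_mono geg_at_1_antimono) auto
  then show "poly (geg_comb v b L w) 1 \<le> (\<Sum>a<L. w (Suc a)) * poly (geg v (Suc b)) 1"
    by (simp add: sum_distrib_right)
qed

lemma spherical_code_card_le_subeigenvector:
  assumes code: "spherical_code (v + 2) s I x" and v: "v \<ge> 2" and L: "L \<ge> 1"
    and w: "geg_subeigenvector v b L \<rho> w" and s: "s \<le> \<rho>" "s \<le> 1"
  shows "real (card I) * ((\<rho> - s) * (w 1)\<^sup>2 * geg_sqnorm v (Suc b))
    \<le> (1 - s) * ((\<Sum>a<L. w (Suc a)) * poly (geg v (Suc b)) 1)\<^sup>2"
proof (cases "I = {}")
  case True
  then show ?thesis
    using s by simp
next
  case False
  define g where "g = geg_comb v b L w"
  have v1: "v \<ge> 1" and nonneg: "\<And>a. a < L \<Longrightarrow> w (Suc a) \<ge> 0"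
    using v w by (auto simp: geg_subeigenvector_def)
  have "zonal_posdef (v + 2) ([:- \<rho>, 1:] * g * g
      + smult (\<rho> - s) (g * g - [:(w 1)\<^sup>2 * geg_sqnorm v (Suc b):]))"
    unfolding g_def using v1 v L s nonneg
    by (intro zonal_posdef_add zonal_posdef_smult zonal_posdef_mult zonal_posdef_geg_comb
        zonal_posdef_linear_mult_geg_comb w zonal_posdef_geg_comb_square) auto
  also have "[:- \<rho>, 1:] * g * g + smult (\<rho> - s) (g * g - [:(w 1)\<^sup>2 * geg_sqnorm v (Suc b):])
      = [:- s, 1:] * (g * g) - [:(\<rho> - s) * (w 1)\<^sup>2 * geg_sqnorm v (Suc b):]"
    by (simp add: algebra_simps smult_diff_left smult_diff_right)
  finally have posdef: "zonal_posdef (v + 2)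
      ([:- s, 1:] * (g * g) - [:(\<rho> - s) * (w 1)\<^sup>2 * geg_sqnorm v (Suc b):])" .
  have poly_test: "poly ([:- s, 1:] * (g * g)) t = (t - s) * (poly g t)\<^sup>2" for t
    by (simp add: power2_eq_square algebra_simps)
  have "real (card I) * ((\<rho> - s) * (w 1)\<^sup>2 * geg_sqnorm v (Suc b)) \<le> (1 - s) * (poly g 1)\<^sup>2"
    unfolding poly_test[symmetric]
    by (rule delsarte_bound[OF code False _ posdef])
      (simp only: poly_test, simp add: mult_nonpos_nonneg)
  also have "\<dots> \<le> (1 - s) * ((\<Sum>a<L. w (Suc a)) * poly (geg v (Suc b)) 1)\<^sup>2"
    unfolding g_def using s geg_comb_at_1[where L = L and w = w, OF v1 nonneg]
    by (intro mult_left_mono power_mono) auto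
  finally show ?thesis .
qed

text \<open>Conjugating the recurrence by the powers of \<open>\<mu> = \<surd>\<beta>\<close> makes it \<open>\<mu>\<close> times the adjacency
  matrix of a path with \<open>L\<close> vertices, whose top eigenvector is a sine.\<close>

definition sine_window :: "nat \<Rightarrow> real \<Rightarrow> nat \<Rightarrow> real" where
  "sine_window L \<mu> a = sin (real a * (pi / real (Suc L))) / \<mu> ^ a"

definition window_eigenvalue :: "nat \<Rightarrow> real \<Rightarrow> real" where
  "window_eigenvalue L \<mu> = 2 * \<mu> * cos (pi / real (Suc L))"

lemma sin_multiples_sum:
  "sin (real a * \<theta>) + sin (real (a + 2) * \<theta>) = 2 * cos \<theta> * sin (real (Suc a) * \<theta>)"
proof -
  have "sin (real (Suc a) * \<theta> - \<theta>) + sin (real (Suc a) * \<theta> + \<theta>)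
      = 2 * cos \<theta> * sin (real (Suc a) * \<theta>)"
    by (simp add: sin_add sin_diff)
  then show ?thesis
    by (simp add: algebra_simps)
qed

lemma sine_window_nonneg:
  assumes "a \<le> Suc L" "\<mu> > 0"
  shows "sine_window L \<mu> a \<ge> 0"
proof -
  have "real a * pi \<le> pi * real (Suc L)"
    using assms(1) by (simp add: mult.commute)
  then have "real a * (pi / real (Suc L)) \<le> pi"
    by (simp add: divide_simps)
  then show ?thesis
    using assms(2) unfolding sine_window_def by (intro divide_nonneg_pos sin_ge_zero) auto
qed

lemma sine_window_1_pos:
  assumes "L \<ge> 1" "\<mu> > 0"
  shows "sine_window L \<mu> 1 > 0"
proof -
  have "pi / real (Suc L) < pi"
    using assms(1) by (simp add: divide_simps)
  then show ?thesis
    using assms(2) by (simp add: sine_window_def sin_gt_zero)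
qed

lemma geg_subeigenvector_sine_window:
  assumes "\<mu> > 0" and beta: "\<And>a. \<mu>\<^sup>2 \<le> geg_beta v (b + a + 2)"
  shows "geg_subeigenvector v b L (window_eigenvalue L \<mu>) (sine_window L \<mu>)"
  unfolding geg_subeigenvector_def
proof (intro conjI allI impI)
  let ?w = "sine_window L \<mu>"
  show "?w 0 = 0" "?w (Suc L) = 0"
    by (simp_all add: sine_window_def)
  show "?w a \<ge> 0" if "a \<le> L" for a
    using that assms(1) by (intro sine_window_nonneg) auto
  show "window_eigenvalue L \<mu> * ?w (Suc a) \<le> ?w a + geg_beta v (b + a + 2) * ?w (a + 2)"
    if "a < L" for a
  proof -
    have "window_eigenvalue L \<mu> * ?w (Suc a)
        = (2 * cos (pi / real (Suc L)) * sin (real (Suc a) * (pi / real (Suc L)))) / \<mu> ^ a"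
      using assms(1) by (simp add: sine_window_def window_eigenvalue_def)
    also have "\<dots> = ?w a + \<mu>\<^sup>2 * ?w (a + 2)"
      unfolding sin_multiples_sum[symmetric] using assms(1)
      by (simp add: sine_window_def add_divide_distrib power2_eq_square del: of_nat_add)
    also have "\<dots> \<le> ?w a + geg_beta v (b + a + 2) * ?w (a + 2)"
      using that assms by (intro add_left_mono mult_right_mono sine_window_nonneg) auto
    finally show ?thesis .
  qed
qed

definition code_const :: "nat \<Rightarrow> real \<Rightarrow> real \<Rightarrow> real" where
  "code_const L \<mu> s = (1 - s) * (\<Sum>a<L. sine_window L \<mu> (Suc a))\<^sup>2
     / ((window_eigenvalue L \<mu> - s) * (sine_window L \<mu> 1)\<^sup>2)"

lemma code_const_nonneg:
  assumes "s \<le> 1" "s \<le> window_eigenvalue L \<mu>"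
  shows "code_const L \<mu> s \<ge> 0"
  using assms by (simp add: code_const_def)

lemma spherical_code_card_le_geg:
  assumes code: "spherical_code (v + 2) s I x" and v: "v \<ge> 2" and "k \<ge> 1" "L \<ge> 1"
    and \<mu>: "\<mu> > 0" "\<mu>\<^sup>2 \<le> geg_beta v k" and s: "s < window_eigenvalue L \<mu>" "s \<le> 1"
  shows "real (card I) * geg_sqnorm v k \<le> code_const L \<mu> s * (poly (geg v k) 1)\<^sup>2"
proof -
  obtain b where k: "k = Suc b"
    using \<open>k \<ge> 1\<close> by (cases k) auto
  have "\<mu>\<^sup>2 \<le> geg_beta v (b + a + 2)" for a
    using \<mu>(2) monoD[OF mono_geg_beta[OF v], of k "b + a + 2"] by (simp add: k)
  then have "geg_subeigenvector v b L (window_eigenvalue L \<mu>) (sine_window L \<mu>)"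
    by (rule geg_subeigenvector_sine_window[OF \<mu>(1)])
  from spherical_code_card_le_subeigenvector[OF code v \<open>L \<ge> 1\<close> this _ s(2)]
  have "real (card I) * ((window_eigenvalue L \<mu> - s) * (sine_window L \<mu> 1)\<^sup>2 * geg_sqnorm v k)
      \<le> (1 - s) * ((\<Sum>a<L. sine_window L \<mu> (Suc a)) * poly (geg v k) 1)\<^sup>2"
    using s(1) by (simp only: k)
  moreover have "(window_eigenvalue L \<mu> - s) * (sine_window L \<mu> 1)\<^sup>2 > 0"
    using s(1) sine_window_1_pos[OF \<open>L \<ge> 1\<close> \<mu>(1)] by simp
  ultimately show ?thesis
    unfolding code_const_def power_mult_distrib by (simp add: pos_le_divide_eq mult_ac)
qed

lemma spherical_code_card_le_binomial:
  assumes code: "spherical_code (v + 2) s I x" and v: "v \<ge> 2"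
    and k: "k \<ge> 1" "2 * k \<le> v" and L: "L \<ge> 1"
    and \<mu>: "\<mu> > 0" "\<mu>\<^sup>2 \<le> geg_beta v k" and s: "s < window_eigenvalue L \<mu>" "s \<le> 1"
  shows "real (card I) \<le> 2 * code_const L \<mu> s * real ((k + v - 1) choose k)"
proof -
  define H q B where "H = geg_sqnorm v k" and "q = poly (geg v k) 1"
    and "B = real ((k + v - 1) choose k)"
  have H: "H > 0"
    unfolding H_def using v by (intro geg_sqnorm_pos) simp
  have "q\<^sup>2 * v = (2 * real k + v) * B * H"
    unfolding q_def B_def H_def using v by (intro geg_at_1_square) simp
  also have "\<dots> \<le> (2 * v) * B * H"
    using H k(2) by (intro mult_right_mono) (auto simp: B_def)
  finally have "q\<^sup>2 \<le> 2 * B * H"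
    using v by simp
  have "real (card I) * H \<le> code_const L \<mu> s * q\<^sup>2"
    unfolding H_def q_def by (rule spherical_code_card_le_geg[OF code v k(1) L \<mu> s])
  also have "\<dots> \<le> code_const L \<mu> s * (2 * B * H)"
    using \<open>q\<^sup>2 \<le> 2 * B * H\<close> s by (intro mult_left_mono code_const_nonneg) auto
  finally show ?thesis
    using H by (simp add: B_def)
qed

section \<open>Spherical codes of angle 60 degrees\<close>

lemma binomial_mult_powers_le_1:
  fixes p :: real
  assumes "0 \<le> p" "p \<le> 1" "k \<le> n"
  shows "real (n choose k) * (p ^ k * (1 - p) ^ (n - k)) \<le> 1"
proof -
  have "real (n choose k) * p ^ k * (1 - p) ^ (n - k)
      \<le> (\<Sum>i\<le>n. real (n choose i) * p ^ i * (1 - p) ^ (n - i))"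
    using assms by (intro member_le_sum) auto
  also have "\<dots> = (p + (1 - p)) ^ n"
    by (rule binomial_ring[symmetric])
  finally show ?thesis
    by (simp add: mult.assoc)
qed

lemma choose_27_2_le: "real ((27 * m) choose (2 * m)) \<le> (4/3) ^ (25 * m)"
proof -
  define c :: real where "c = (2/27) ^ 2 * (25/27) ^ 25"
  have "c > 0"
    by (simp add: c_def)
  have "(2/27) ^ (2 * m) * (1 - 2/27) ^ (27 * m - 2 * m) = c ^ m"
    by (simp add: c_def power_mult power_mult_distrib)
  then have "real ((27 * m) choose (2 * m)) * c ^ m \<le> 1"
    using binomial_mult_powers_le_1[of "2/27" "2 * m" "27 * m"] by simp
  also have "1 \<le> ((4/3) ^ 25 * c) ^ m"
    by (rule one_le_power) (simp add: c_def power_divide)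
  also have "\<dots> = (4/3) ^ (25 * m) * c ^ m"
    by (simp only: power_mult power_mult_distrib)
  finally show ?thesis
    using \<open>c > 0\<close> by simp
qed

lemma cos_pi_50_ge: "cos (pi / 50) \<ge> 996/1000"
proof -
  have "\<bar>sin (pi / 100)\<bar> \<le> pi / 100"
    using abs_sin_x_le_abs_x[of "pi / 100"] by simp
  also have "\<dots> \<le> 4 / 100"
    using pi_less_4 by simp
  finally have "(sin (pi / 100))\<^sup>2 \<le> (4 / 100)\<^sup>2"
    by (simp add: abs_le_square_iff[symmetric])
  moreover have "cos (pi / 50) = 1 - 2 * (sin (pi / 100))\<^sup>2"
    using cos_double_sin[of "pi / 100"] by simp
  ultimately show ?thesis
    by (simp add: power2_eq_square)
qed

text \<open>The condition \<open>2 \<surd>\<beta>\<^sub>k > 1/2\<close> for \<open>k = \<kappa> d\<close> requires \<open>\<kappa>\<close> to be at least about \<open>0.0774\<close>,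
  and the bound \<open>(4/3)^d\<close> for the binomial coefficient requires it to be at most about \<open>0.0809\<close>. The
  choice \<open>\<kappa> = 2/25\<close> leads to \<open>\<beta>\<^sub>k \<approx> 54/841\<close>, hence to \<open>\<mu> = 0.253\<close>, and \<open>L = 49\<close> brings the cosine
  close enough to 1.\<close>

lemma half_less_eigenvalue: "(1/2 :: real) < window_eigenvalue 49 (253/1000)"
  using cos_pi_50_ge by (simp add: window_eigenvalue_def)

lemma code_const_half_nonneg: "code_const 49 (253/1000) (1/2) \<ge> 0"
  using half_less_eigenvalue by (intro code_const_nonneg) auto

lemma geg_beta_25_2_ge:
  assumes "m \<ge> 1"
  shows "geg_beta (25 * m - 2) (2 * m) \<ge> (253/1000)\<^sup>2"
proof -
  define M where "M = real m"
  have M: "M \<ge> 1" "real (25 * m - 2) = 25 * M - 2"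
    using assms by (simp_all add: M_def of_nat_diff)
  have "0 \<le> M * M"
    by simp
  then have "253\<^sup>2 * ((29 * M - 2) * (29 * M - 4)) \<le> 1000\<^sup>2 * (2 * M * (27 * M - 3))"
    using M(1) by (simp add: algebra_simps; linarith)
  then have "(253/1000)\<^sup>2 * ((29 * M - 2) * (29 * M - 4)) \<le> 2 * M * (27 * M - 3)"
    by (simp add: power2_eq_square)
  moreover have "(29 * M - 2) * (29 * M - 4) > 0"
    using M(1) by simp
  ultimately have "(253/1000)\<^sup>2 \<le> 2 * M * (27 * M - 3) / ((29 * M - 2) * (29 * M - 4))"
    by (simp add: pos_le_divide_eq)
  also have "\<dots> = geg_beta (25 * m - 2) (2 * m)"
    unfolding geg_beta_def M(2) by (simp add: M_def algebra_simps)
  finally show ?thesis .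
qed

lemma spherical_code_card_le_multiple:
  assumes code: "spherical_code (25 * m) (1/2) I x" and m: "m \<ge> 1"
  shows "real (card I) \<le> 2 * code_const 49 (253/1000) (1/2) * (4/3) ^ (25 * m)"
proof -
  let ?C = "code_const 49 (253/1000) (1/2)"
  define v where "v = 25 * m - 2"
  have v: "v + 2 = 25 * m" "v \<ge> 2" "2 * (2 * m) \<le> v"
    using m by (simp_all add: v_def)
  have "real (card I) \<le> 2 * ?C * real ((2 * m + v - 1) choose (2 * m))"
    using code m v half_less_eigenvalue geg_beta_25_2_ge[OF m]
    by (intro spherical_code_card_le_binomial[of v "1/2" I x]) (auto simp: v_def)
  also have "real ((2 * m + v - 1) choose (2 * m)) \<le> real ((27 * m) choose (2 * m))"
    using v(1) by (intro of_nat_mono binomial_right_mono) auto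
  also have "\<dots> \<le> (4/3) ^ (25 * m)"
    by (rule choose_27_2_le)
  finally show ?thesis
    using code_const_half_nonneg by (simp add: mult_left_mono)
qed

lemma spherical_code_pad:
  assumes "spherical_code d s I x" "d \<le> n"
  shows "spherical_code n s I (\<lambda>i k. if k < d then x i k else 0)"
proof -
  have "dot n (\<lambda>k. if k < d then y k else 0) (\<lambda>k. if k < d then z k else 0) = dot d y z" for y z
    unfolding dot_def by (rule sum.mono_neutral_cong_right) (use assms(2) in auto)
  then show ?thesis
    using assms(1) by (simp add: spherical_code_def unit_vec_def)
qed

definition kissing_const :: real where
  "kissing_const = 2 * code_const 49 (253/1000) (1/2) * (4/3) ^ 25"

lemma kissing_const_nonneg: "kissing_const \<ge> 0"
  using code_const_half_nonneg by (simp add: kissing_const_def)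

lemma spherical_code_card_le:
  assumes "spherical_code d (1/2) I x"
  shows "real (card I) \<le> kissing_const * (4/3) ^ d"
proof -
  define m where "m = d div 25 + 1"
  have m: "m \<ge> 1" "d \<le> 25 * m" "25 * m \<le> 25 + d"
    unfolding m_def by simp_all
  have "real (card I) \<le> 2 * code_const 49 (253/1000) (1/2) * (4/3) ^ (25 * m)"
    by (rule spherical_code_card_le_multiple[OF spherical_code_pad[OF assms m(2)] m(1)])
  also have "\<dots> \<le> 2 * code_const 49 (253/1000) (1/2) * (4/3) ^ (25 + d)"
    using m(3) code_const_half_nonneg by (intro mult_left_mono power_increasing) auto
  finally show ?thesis
    by (simp add: kissing_const_def power_add mult.assoc)
qed

section \<open>Separated points on the torus\<close>

lemma dot_diff_self:
  "dot n (\<lambda>k. x k - y k) (\<lambda>k. x k - y k) = dot n x x + dot n y y - 2 * dot n x y"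
  by (simp add: dot_def sum_distrib_left algebra_simps flip: sum.distrib sum_subtractf)

lemma min_le_sqrt_mult:
  fixes a b :: real
  assumes "a \<ge> 0" "b \<ge> 0"
  shows "min a b \<le> sqrt a * sqrt b"
proof -
  have "min a b = sqrt (min a b) * sqrt (min a b)"
    using assms by simp
  also have "\<dots> \<le> sqrt a * sqrt b"
    using assms by (intro mult_mono) auto
  finally show ?thesis .
qed

lemma card_separated_vectors:
  assumes "finite I" and pos: "\<And>i. i \<in> I \<Longrightarrow> dot d (x i) (x i) > 0"
    and sep: "\<And>i j. i \<in> I \<Longrightarrow> j \<in> I \<Longrightarrow> i \<noteq> j \<Longrightarrow>
      dot d (x i) (x i) \<le> dot d (\<lambda>k. x i k - x j k) (\<lambda>k. x i k - x j k)"
  shows "real (card I) \<le> kissing_const * (4/3) ^ d"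
proof (rule spherical_code_card_le)
  define y where "y i k = x i k / sqrt (dot d (x i) (x i))" for i k
  have dot_y: "dot d (y i) (y j)
      = dot d (x i) (x j) / (sqrt (dot d (x i) (x i)) * sqrt (dot d (x j) (x j)))" for i j
    unfolding y_def dot_divide_left dot_divide_right by (simp add: mult.commute)
  have "dot d (y i) (y j) \<le> 1/2" if "i \<in> I" "j \<in> I" "i \<noteq> j" for i j
  proof -
    have "2 * dot d (x i) (x j) \<le> min (dot d (x i) (x i)) (dot d (x j) (x j))"
      using sep[of i j] sep[of j i] that by (simp add: dot_diff_self dot_commute[of d "x j" "x i"])
    also have "\<dots> \<le> sqrt (dot d (x i) (x i)) * sqrt (dot d (x j) (x j))"
      by (intro min_le_sqrt_mult dot_self_nonneg)
    finally show ?thesis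
      unfolding dot_y using pos[OF that(1)] pos[OF that(2)] by (simp add: pos_divide_le_eq)
  qed
  moreover have "unit_vec d (y i)" if "i \<in> I" for i
    using pos[OF that] by (simp add: unit_vec_def dot_y)
  ultimately show "spherical_code d (1/2) I y"
    using assms(1) by (simp add: spherical_code_def)
qed

lemma dist_Z_le: "dist_Z x \<le> \<bar>x - of_int n\<bar>"
  unfolding dist_Z_def by (rule cINF_lower) (auto intro!: bdd_belowI[of _ 0])

lemma dist_Z_eq_round: "dist_Z x = \<bar>x - of_int (round x)\<bar>"
proof (rule antisym[OF dist_Z_le])
  show "\<bar>x - of_int (round x)\<bar> \<le> dist_Z x"
    unfolding dist_Z_def by (rule cINF_greatest) (auto intro: round_diff_minimal)
qed

lemma dist_Z_minus: "dist_Z (- x) = dist_Z x"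
proof -
  have "dist_Z (- y) \<le> dist_Z y" for y
    using dist_Z_le[of "- y" "- round y"] unfolding dist_Z_eq_round[of y] by simp
  from this[of x] this[of "- x"] show ?thesis
    by simp
qed

lemma torus_norm_nonneg: "torus_norm d t \<ge> 0"
  by (simp add: torus_norm_def sum_nonneg)

lemma torus_norm_square: "(torus_norm d t)\<^sup>2 = (\<Sum>k<d. (dist_Z (t k))\<^sup>2)"
  by (simp add: torus_norm_def sum_nonneg)

lemma torus_norm_sign:
  assumes "s \<in> {1, -1}"
  shows "torus_norm d (\<lambda>k. s * t k) = torus_norm d t"
  using assms by (auto simp: torus_norm_def dist_Z_minus)

lemma torus_class_eq_0:
  assumes "torus_norm d t = 0"
  shows "torus_class d t = (\<lambda>k. 0)"
proof
  fix k
  have "t k \<in> \<int>" if "k < d"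
  proof -
    have "dist_Z (t k) = 0"
      using torus_norm_square[of d t] that by (simp add: assms sum_nonneg_eq_0_iff)
    then have "t k = of_int (round (t k))"
      by (simp add: dist_Z_eq_round)
    then show ?thesis
      by (metis Ints_of_int)
  qed
  then show "torus_class d t k = 0"
    by (simp add: torus_class_def frac_eq_0_iff)
qed

definition reduced :: "vec \<Rightarrow> vec" where
  "reduced t k = t k - of_int (round (t k))"

lemma dot_reduced: "dot d (reduced t) (reduced t) = (torus_norm d t)\<^sup>2"
  unfolding torus_norm_square by (simp add: dot_def reduced_def dist_Z_eq_round power2_eq_square)

lemma torus_norm_diff_le_reduced:
  "(torus_norm d (\<lambda>k. t k - u k))\<^sup>2
    \<le> dot d (\<lambda>k. reduced t k - reduced u k) (\<lambda>k. reduced t k - reduced u k)"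
  unfolding torus_norm_square dot_def power2_eq_square[symmetric]
proof (rule sum_mono)
  fix k
  have "dist_Z (t k - u k) \<le> \<bar>reduced t k - reduced u k\<bar>"
    using dist_Z_le[of "t k - u k" "round (t k) - round (u k)"]
    by (simp add: reduced_def algebra_simps)
  then show "(dist_Z (t k - u k))\<^sup>2 \<le> (reduced t k - reduced u k)\<^sup>2"
    unfolding abs_le_square_iff[symmetric] by (simp add: dist_Z_eq_round)
qed

lemma card_torus_separated:
  assumes "finite I" and pos: "\<And>i. i \<in> I \<Longrightarrow> torus_norm d (t i) > 0"
    and sep: "\<And>i j. i \<in> I \<Longrightarrow> j \<in> I \<Longrightarrow> i \<noteq> j \<Longrightarrow>
      torus_norm d (t i) \<le> torus_norm d (\<lambda>k. t i k - t j k)"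
  shows "real (card I) \<le> kissing_const * (4/3) ^ d"
proof (rule card_separated_vectors[of I d "\<lambda>i. reduced (t i)"])
  show "dot d (reduced (t i)) (reduced (t i))
      \<le> dot d (\<lambda>k. reduced (t i) k - reduced (t j) k) (\<lambda>k. reduced (t i) k - reduced (t j) k)"
    if "i \<in> I" "j \<in> I" "i \<noteq> j" for i j
    unfolding dot_reduced
    using power_mono[OF sep[OF that] torus_norm_nonneg] torus_norm_diff_le_reduced
    by (rule order_trans)
  show "dot d (reduced (t i)) (reduced (t i)) > 0" if "i \<in> I" for i
    unfolding dot_reduced using pos[OF that] by simp
qed (fact assms(1))

section \<open>Nearest neighbours\<close>

definition gap :: "nat \<Rightarrow> nat \<Rightarrow> nat" where
  "gap i j = (if j < i then i - j else j - i)"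

lemma wpt_diff_eq_gap:
  "\<exists>s\<in>{1, -1}. (\<lambda>k. wpt \<alpha> i k - wpt \<alpha> j k) = (\<lambda>k. s * wpt \<alpha> (gap i j) k)"
  by (rule bexI[of _ "if j < i then 1 else -1"])
    (auto simp: gap_def wpt_def of_nat_diff algebra_simps not_less)

lemma torus_norm_wpt_diff:
  "torus_norm d (\<lambda>k. wpt \<alpha> i k - wpt \<alpha> j k) = torus_norm d (wpt \<alpha> (gap i j))"
proof -
  obtain s where "s \<in> {1, -1}"
    and diff: "(\<lambda>k. wpt \<alpha> i k - wpt \<alpha> j k) = (\<lambda>k. s * wpt \<alpha> (gap i j) k)"
    using wpt_diff_eq_gap by blast
  then show ?thesis
    unfolding diff by (intro torus_norm_sign)
qed

lemma card_best_multiples: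
  assumes "finite M" and pos: "\<And>m. m \<in> M \<Longrightarrow> torus_norm d (wpt \<alpha> m) > 0"
    and best: "\<And>m l. m \<in> M \<Longrightarrow> l \<in> {1..h} \<Longrightarrow> torus_norm d (wpt \<alpha> m) \<le> torus_norm d (wpt \<alpha> l)"
    and close: "\<And>m m'. m \<in> M \<Longrightarrow> m' \<in> M \<Longrightarrow> gap m m' \<le> h"
  shows "real (card M) \<le> kissing_const * (4/3) ^ d"
proof (rule card_torus_separated[OF assms(1) pos])
  fix m m' assume "m \<in> M" "m' \<in> M" "m \<noteq> m'"
  moreover from \<open>m \<noteq> m'\<close> have "gap m m' \<ge> 1"
    by (auto simp: gap_def)
  ultimately show "torus_norm d (wpt \<alpha> m) \<le> torus_norm d (\<lambda>k. wpt \<alpha> m k - wpt \<alpha> m' k)"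
    unfolding torus_norm_wpt_diff by (intro best) (auto intro: close)
qed

definition nearest :: "nat \<Rightarrow> nat \<Rightarrow> vec \<Rightarrow> nat \<Rightarrow> nat \<Rightarrow> bool" where
  "nearest d N \<alpha> i j \<longleftrightarrow> j \<in> {1..N} \<and> j \<noteq> i \<and> (\<forall>j'\<in>{1..N}. j' \<noteq> i \<longrightarrow>
     torus_norm d (\<lambda>k. wpt \<alpha> i k - wpt \<alpha> j k) \<le> torus_norm d (\<lambda>k. wpt \<alpha> i k - wpt \<alpha> j' k))"

lemma nearest_gap_le:
  assumes "nearest d N \<alpha> i j" "i \<in> {1..N}" "l \<in> {1..(N - 1) div 2}"
  shows "torus_norm d (wpt \<alpha> (gap i j)) \<le> torus_norm d (wpt \<alpha> l)"
proof -
  define j' where "j' = (if l < i then i - l else i + l)"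
  have "j' \<in> {1..N}" "j' \<noteq> i" "gap i j' = l"
    using assms(2,3) by (auto simp: j'_def gap_def)
  then show ?thesis
    using assms(1) unfolding nearest_def torus_norm_wpt_diff by metis
qed

definition nonzero_gaps :: "nat \<Rightarrow> nat \<Rightarrow> vec \<Rightarrow> (nat \<Rightarrow> nat) \<Rightarrow> nat set" where
  "nonzero_gaps d N \<alpha> j = {m \<in> (\<lambda>i. gap i (j i)) ` {1..N}. torus_norm d (wpt \<alpha> m) > 0}"

lemma finite_nonzero_gaps: "finite (nonzero_gaps d N \<alpha> j)"
  by (simp add: nonzero_gaps_def)

lemma card_nonzero_gaps_le:
  assumes nearest: "\<And>i. i \<in> {1..N} \<Longrightarrow> nearest d N \<alpha> i (j i)"
  shows "real (card (nonzero_gaps d N \<alpha> j)) \<le> 2 * kissing_const * (4/3) ^ d"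
proof -
  let ?G = "nonzero_gaps d N \<alpha> j"
  define h where "h = (N - 1) div 2"
  have nearest_gap: "\<exists>i\<in>{1..N}. m = gap i (j i) \<and> nearest d N \<alpha> i (j i)" if "m \<in> ?G" for m
    using that nearest unfolding nonzero_gaps_def by blast
  have gap_le: "m \<le> N - 1" if "m \<in> ?G" for m
    using nearest_gap[OF that] by (auto simp: nearest_def gap_def)
  have best: "torus_norm d (wpt \<alpha> m) \<le> torus_norm d (wpt \<alpha> l)" if "m \<in> ?G" "l \<in> {1..h}" for m l
    using nearest_gap[OF that(1)] that(2) nearest_gap_le unfolding h_def by blast
  have card_part: "real (card M) \<le> kissing_const * (4/3) ^ d"
    if "M \<subseteq> ?G" "\<And>m m'. m \<in> M \<Longrightarrow> m' \<in> M \<Longrightarrow> gap m m' \<le> h" for M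
  proof (rule card_best_multiples)
    show "finite M"
      using that(1) finite_nonzero_gaps by (rule finite_subset)
    show "torus_norm d (wpt \<alpha> m) > 0" if "m \<in> M" for m
      using \<open>M \<subseteq> ?G\<close> that by (auto simp: nonzero_gaps_def)
  qed (use that best in blast)+
  have "real (card {m \<in> ?G. m \<le> h}) \<le> kissing_const * (4/3) ^ d"
    by (rule card_part) (auto simp: gap_def)
  moreover have "gap m m' \<le> h" if "m \<in> ?G" "m' \<in> ?G" "m > h" "m' > h" for m m'
    using gap_le[OF that(1)] gap_le[OF that(2)] that(3,4) by (auto simp: gap_def h_def)
  then have "real (card {m \<in> ?G. m > h}) \<le> kissing_const * (4/3) ^ d"
    by (intro card_part) auto
  moreover have "?G = {m \<in> ?G. m \<le> h} \<union> {m \<in> ?G. m > h}"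
    by auto
  then have "card ?G \<le> card {m \<in> ?G. m \<le> h} + card {m \<in> ?G. m > h}"
    using card_Un_le by metis
  ultimately show ?thesis
    by simp
qed

lemma card_difference_classes_le:
  "card {torus_class d (\<lambda>k. s * (wpt \<alpha> i k - wpt \<alpha> (j i) k)) | s i. s \<in> {1, -1} \<and> i \<in> {1..N}}
    \<le> 1 + 2 * card (nonzero_gaps d N \<alpha> j)" (is "card ?D \<le> _")
proof -
  let ?G = "nonzero_gaps d N \<alpha> j"
  define cls where "cls = (\<lambda>(s::real, m). torus_class d (\<lambda>k. s * wpt \<alpha> m k))"
  have "?D \<subseteq> insert (\<lambda>k. 0) (cls ` ({1, -1} \<times> ?G))"
  proof
    fix y assume "y \<in> ?D"
    then obtain s i where y: "y = torus_class d (\<lambda>k. s * (wpt \<alpha> i k - wpt \<alpha> (j i) k))"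
      and s: "s \<in> {1, -1}" and i: "i \<in> {1..N}"
      by blast
    let ?m = "gap i (j i)"
    obtain s' where s': "s' \<in> {1, -1}"
      and diff: "(\<lambda>k. wpt \<alpha> i k - wpt \<alpha> (j i) k) = (\<lambda>k. s' * wpt \<alpha> ?m k)"
      using wpt_diff_eq_gap by blast
    have y_eq: "y = cls (s * s', ?m)" and sign: "s * s' \<in> {1, -1}"
      using s s' by (auto simp: y cls_def fun_cong[OF diff])
    show "y \<in> insert (\<lambda>k. 0) (cls ` ({1, -1} \<times> ?G))"
    proof (cases "torus_norm d (wpt \<alpha> ?m) = 0")
      case True
      then show ?thesis
        unfolding y_eq cls_def using torus_norm_sign[OF sign, of d "wpt \<alpha> ?m"]
        by (simp add: torus_class_eq_0)
    next
      case False
      then have "?m \<in> ?G"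
        using torus_norm_nonneg[of d "wpt \<alpha> ?m"] i by (simp add: nonzero_gaps_def)
      then show ?thesis
        unfolding y_eq using sign by blast
    qed
  qed
  then have "card ?D \<le> card (insert (\<lambda>k. 0) (cls ` ({1, -1} \<times> ?G)))"
    by (intro card_mono) (simp_all add: finite_nonzero_gaps)
  also have "\<dots> \<le> 1 + card (cls ` ({1, -1} \<times> ?G))"
    by (simp add: card_insert_if finite_nonzero_gaps)
  also have "\<dots> \<le> 1 + card ({1, -1 :: real} \<times> ?G)"
    by (intro add_left_mono card_image_le) (simp add: finite_nonzero_gaps)
  finally show ?thesis
    by (simp add: card_cartesian_product)
qed

theorem theorem3:
  shows "\<exists>K::real. K > 0 \<and>
    (\<forall>(d::nat) (N::nat) (\<alpha>::nat \<Rightarrow> real) (j::nat \<Rightarrow> nat).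
       d \<ge> 1 \<longrightarrow> N \<ge> 2 \<longrightarrow>
       (\<forall>i\<in>{1..N}. j i \<in> {1..N} \<and> j i \<noteq> i \<and>
          (\<forall>j'\<in>{1..N}. j' \<noteq> i \<longrightarrow>
             torus_norm d (\<lambda>k. wpt \<alpha> i k - wpt \<alpha> (j i) k)
               \<le> torus_norm d (\<lambda>k. wpt \<alpha> i k - wpt \<alpha> j' k))) \<longrightarrow>
       real (card {torus_class d (\<lambda>k. s * (wpt \<alpha> i k - wpt \<alpha> (j i) k)) | s i.
                     s \<in> {1, -1} \<and> i \<in> {1..N}})
         \<le> K * (4/3) ^ d)"
proof (rule exI[of _ "1 + 4 * kissing_const"], intro conjI allI impI)
  show "1 + 4 * kissing_const > 0"
    using kissing_const_nonneg by simp
next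
  fix d N :: nat and \<alpha> :: "nat \<Rightarrow> real" and j :: "nat \<Rightarrow> nat"
  let ?D = "{torus_class d (\<lambda>k. s * (wpt \<alpha> i k - wpt \<alpha> (j i) k)) | s i. s \<in> {1, -1} \<and> i \<in> {1..N}}"
  assume "\<forall>i\<in>{1..N}. j i \<in> {1..N} \<and> j i \<noteq> i \<and>
    (\<forall>j'\<in>{1..N}. j' \<noteq> i \<longrightarrow> torus_norm d (\<lambda>k. wpt \<alpha> i k - wpt \<alpha> (j i) k)
      \<le> torus_norm d (\<lambda>k. wpt \<alpha> i k - wpt \<alpha> j' k))"
  then have "nearest d N \<alpha> i (j i)" if "i \<in> {1..N}" for i
    using that unfolding nearest_def by blast
  then have "real (card (nonzero_gaps d N \<alpha> j)) \<le> 2 * kissing_const * (4/3) ^ d"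
    by (rule card_nonzero_gaps_le)
  moreover have "real (card ?D) \<le> 1 + 2 * real (card (nonzero_gaps d N \<alpha> j))"
    using of_nat_mono[OF card_difference_classes_le, where 'a = real] by simp
  moreover have "1 \<le> (4/3 :: real) ^ d"
    by (rule one_le_power) simp
  ultimately have "real (card ?D) \<le> (4/3) ^ d + 2 * (2 * kissing_const * (4/3) ^ d)"
    by linarith
  then show "real (card ?D) \<le> (1 + 4 * kissing_const) * (4/3) ^ d"
    by (simp add: algebra_simps)
qed

end
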